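(* For $n\in\mathbb{N}$ consider the condition $$\beta > \beta_n^{\mathrm{cr}},\qquad \beta_n^{\mathrm{cr}} := \frac{\varkappa\,(c_1\lambda_1^n + c_2\lambda_2^n) - \frac{\varkappa^2}{2b_0}\,(c_1\lambda_1^{n-1}+c_2\lambda_2^{n-1})}{c_1\lambda_1^n + c_2\lambda_2^n},$$ where $$\lambda_{1} = \frac{(1+\varkappa/b_0) + \sqrt{1+2\varkappa/b_0}}{2},\qquad \lambda_{2} = \frac{(1+\varkappa/b_0) - \sqrt{1+2\varkappa/b_0}}{2},$$ and $c_1,c_2$ are determined by $$c_1\lambda_1 + c_2\lambda_2 = 1 + \frac{\varkappa}{2b_0},\qquad c_1\lambda_1^2+c_2\lambda_2^2 = 1 + \frac{3\varkappa}{2b_0} + \frac{\varkappa^2}{4b_0^2}.$$ Then, as $n\to\infty$, this condition takes the form $$\beta^* > b_0\sqrt{1+2\varkappa/b_0},$$ where $\beta^*=\beta+b_0$; that is, the threshold for $\beta^*$ satisfies $$\lim_{n\to\infty}\left(\beta_n^{\mathrm{cr}} + b_0\right) = b_0\sqrt{1+2\varkappa/b_0}.$$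
   Context: Here $\varkappa>0$ (walking intensity) and $b_0>0$ (death intensity) are real parameters. The branching intensity at the particle generation center is $\beta=f'(1)$, where $f(u)=\sum_{m\ge 0} b_m u^m$ with $b_m\ge 0$ for $m\ne 1$, $b_1<0$, $\sum_{m\ge 0} b_m=0$; the intensity of pure reproduction is $\beta^*=\sum_{m>1}(m-1)b_m>0$ (assumed finite), so that $\beta=\beta^*-b_0$. The condition $\beta>\beta_n^{\mathrm{cr}}$ is the condition providing exponential growth of particle numbers in the branching random walk on $\mathbb{Z}$ with one particle generation center at $0$ and $2n$ absorbing sources of death intensity $b_0$ at the points $\pm1,\dots,\pm n$. *)

theory Defs
  imports "HOL-Analysis.Analysis"
begin

text \<open>The continuous-time branching law at the particle generation center: \<open>b m\<close> is the
  intensity of a particle being replaced by \<open>m\<close> particles, \<open>b 0\<close> is the death intensity.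
  The last two conjuncts say that the intensity of pure reproduction is finite and positive.\<close>

definition pure_reproduction :: "(nat \<Rightarrow> real) \<Rightarrow> real" where
  "pure_reproduction b = (\<Sum>\<^sub>\<infinity>m\<in>{1<..}. (real m - 1) * b m)"

definition branching_law :: "(nat \<Rightarrow> real) \<Rightarrow> bool" where
  "branching_law b \<longleftrightarrow>
     (\<forall>m. m \<noteq> 1 \<longrightarrow> b m \<ge> 0) \<and> b 1 < 0 \<and> b sums 0 \<and>
     (\<lambda>m. (real m - 1) * b m) summable_on {1<..} \<and> pure_reproduction b > 0"

definition gen_fun :: "(nat \<Rightarrow> real) \<Rightarrow> real \<Rightarrow> real" where
  "gen_fun b u = (\<Sum>m. b m * u ^ m)"

text \<open>The derivative at \<open>1\<close> is one-sided, since the radius of convergence of the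
  generating function may be exactly \<open>1\<close>.\<close>

definition branching_intensity :: "(nat \<Rightarrow> real) \<Rightarrow> real" where
  "branching_intensity b = vector_derivative (gen_fun b) (at 1 within {0..1})"

definition lambda1 :: "real \<Rightarrow> real \<Rightarrow> real" where
  "lambda1 \<kappa> b0 = ((1 + \<kappa> / b0) + sqrt (1 + 2 * \<kappa> / b0)) / 2"

definition lambda2 :: "real \<Rightarrow> real \<Rightarrow> real" where
  "lambda2 \<kappa> b0 = ((1 + \<kappa> / b0) - sqrt (1 + 2 * \<kappa> / b0)) / 2"

text \<open>The critical value is meaningful for \<open>n \<ge> 1\<close>; at \<open>n = 0\<close> the truncated exponent
  \<open>n - 1\<close> makes it a junk value.\<close>

definition beta_cr :: "real \<Rightarrow> real \<Rightarrow> real \<Rightarrow> real \<Rightarrow> nat \<Rightarrow> real" where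
  "beta_cr \<kappa> b0 c1 c2 n =
     (\<kappa> * (c1 * lambda1 \<kappa> b0 ^ n + c2 * lambda2 \<kappa> b0 ^ n)
        - \<kappa>\<^sup>2 / (2 * b0) * (c1 * lambda1 \<kappa> b0 ^ (n - 1) + c2 * lambda2 \<kappa> b0 ^ (n - 1)))
     / (c1 * lambda1 \<kappa> b0 ^ n + c2 * lambda2 \<kappa> b0 ^ n)"

end

theory Submission
  imports Defs
begin

text \<open>With \<open>s = sqrt (1 + 2\<kappa>/b\<^sub>0)\<close> the roots are \<open>\<lambda>\<^sub>1 = (s + 1)\<^sup>2/4\<close> and \<open>\<lambda>\<^sub>2 = (s - 1)\<^sup>2/4\<close>, and the
  initial conditions give \<open>c\<^sub>1 \<lambda>\<^sub>1 s = (s + 1)\<^sup>3/8 > 0\<close>. Hence \<open>\<lambda>\<^sub>1\<close> dominates and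
  \<open>\<beta>\<^sub>n\<^sup>c\<^sup>r\<close> tends to \<open>\<kappa> - \<kappa>\<^sup>2/(2 b\<^sub>0 \<lambda>\<^sub>1) = b\<^sub>0 (s - 1)\<close>. The identity \<open>\<beta>\<^sup>* = \<beta> + b\<^sub>0\<close> is
  term-by-term differentiation of the generating function on \<open>[0, 1]\<close>, which is
  permitted by absolute convergence of \<open>\<Sum> m b\<^sub>m\<close>.\<close>

text \<open>On \<open>{0..1}\<close> the powers of \<open>x\<close> are at most 1, so
  \<open>\<bar>real m * b m\<bar>\<close> majorizes the differentiated series uniformly. This
  includes the endpoint 1, even if it lies on the circle of convergence.\<close>

lemma gen_fun_has_field_derivative:
  assumes "summable (\<lambda>m. \<bar>real m * b m\<bar>)" "summable b" "x \<in> {0..1}"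
  shows "(gen_fun b has_field_derivative (\<Sum>m. real m * b m * x ^ (m - 1))) (at x within {0..1})"
proof -
  have lim: "uniform_limit {0..1} (\<lambda>n x. \<Sum>i<n. real i * b i * x ^ (i - 1))
      (\<lambda>x. \<Sum>m. real m * b m * x ^ (m - 1)) sequentially"
    using assms(1)
    by (intro Weierstrass_m_test)
       (auto simp: abs_mult power_abs intro!: mult_left_le power_le_one)
  \<comment> \<open>At the base point 1 the series is the sum of \<open>b\<close> itself. The rule
    yields only some \<open>g\<close>; uniqueness of sums identifies it with
    \<open>gen_fun b\<close>.\<close>
  have "\<exists>g. \<forall>x\<in>{0..1}. (\<lambda>m. b m * x ^ m) sums g x \<and>
      (g has_field_derivative (\<Sum>m. real m * b m * x ^ (m - 1))) (at x within {0..1})"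
    by (rule has_field_derivative_series[OF _ _ lim, where ?x0.0 = 1])
       (use assms(2) in \<open>auto intro!: derivative_eq_intros\<close>)
  then obtain g where g: "\<And>x. x \<in> {0..1} \<Longrightarrow> (\<lambda>m. b m * x ^ m) sums g x"
    "\<And>x. x \<in> {0..1} \<Longrightarrow>
      (g has_field_derivative (\<Sum>m. real m * b m * x ^ (m - 1))) (at x within {0..1})"
    by blast
  have "g y = gen_fun b y" if "y \<in> {0..1}" for y
    using g(1)[OF that] by (simp add: gen_fun_def sums_iff)
  with g(2)[OF assms(3)] assms(3) show ?thesis
    by (auto intro: has_field_derivative_transform_within[where d = 1])
qed

lemma branching_intensity_eq_suminf:
  assumes "summable (\<lambda>m. \<bar>real m * b m\<bar>)" "summable b"
  shows "branching_intensity b = (\<Sum>m. real m * b m)"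
proof -
  have "(gen_fun b has_vector_derivative (\<Sum>m. real m * b m)) (at 1 within {0..1})"
    using gen_fun_has_field_derivative[OF assms, of 1]
    by (simp add: has_real_derivative_iff_has_vector_derivative)
  then show ?thesis
    unfolding branching_intensity_def
    by (intro vector_derivative_within_closed_interval) auto
qed

lemma pure_reproduction_eq:
  assumes "branching_law b"
  shows "pure_reproduction b = branching_intensity b + b 0"
proof -
  have nonneg: "\<And>m. m \<noteq> 1 \<Longrightarrow> b m \<ge> 0"
    and sums0: "b sums 0"
    and summ: "(\<lambda>m. (real m - 1) * b m) summable_on {1<..}"
    using assms by (auto simp: branching_law_def)
  have "((\<lambda>m. (real m - 1) * b m) has_sum pure_reproduction b) {1<..}"
    using summ by (simp add: pure_reproduction_def)
  \<comment> \<open>The extra \<open>b 0\<close> cancels the term -\<open>b 0\<close> at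
    \<open>m = 0\<close>, and the factor \<open>real m - 1\<close> vanishes at \<open>m = 1\<close>,
    so extending to all indices adds only zeros.\<close>
  also have "?this \<longleftrightarrow>
      ((\<lambda>m. (real m - 1) * b m + (if m = 0 then b 0 else 0)) has_sum pure_reproduction b) UNIV"
    by (intro has_sum_cong_neutral) (auto simp: not_less le_Suc_eq)
  finally have "(\<lambda>m. (real m - 1) * b m + (if m = 0 then b 0 else 0)) sums pure_reproduction b"
    by (rule has_sum_imp_sums)
  \<comment> \<open>Removing the correction and adding the zero sum of \<open>b\<close> turns
    \<open>(real m - 1) * b m\<close> into \<open>real m * b m\<close>.\<close>
  from sums_add[OF sums_diff[OF this sums_If_finite_set[of "{0}" b]] sums0]
  have sums: "(\<lambda>m. real m * b m) sums (pure_reproduction b - b 0)"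
    by (simp add: algebra_simps cong: if_cong)
  \<comment> \<open>Only \<open>b 1\<close> is negative, so from \<open>m = 2\<close> on the terms
    equal their absolute values.\<close>
  have "summable (\<lambda>m. \<bar>real m * b m\<bar>)"
  proof (rule summable_comparison_test_ev[OF _ sums_summable[OF sums]])
    show "\<forall>\<^sub>F m in sequentially. norm \<bar>real m * b m\<bar> \<le> real m * b m"
      using eventually_gt_at_top[of 1] by eventually_elim (simp add: nonneg)
  qed
  from branching_intensity_eq_suminf[OF this sums_summable[OF sums0]] sums_unique[OF sums]
  show ?thesis by simp
qed

lemma lambda1_eq_square:
  assumes "\<kappa> > 0" "b0 > 0"
  shows "lambda1 \<kappa> b0 = (sqrt (1 + 2 * \<kappa> / b0) + 1)\<^sup>2 / 4"
  using assms by (simp add: lambda1_def power2_sum field_simps)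

lemma lambda2_eq_square:
  assumes "\<kappa> > 0" "b0 > 0"
  shows "lambda2 \<kappa> b0 = (sqrt (1 + 2 * \<kappa> / b0) - 1)\<^sup>2 / 4"
  using assms by (simp add: lambda2_def power2_diff field_simps)

text \<open>Divide numerator and denominator by the dominant power of \<open>p\<close>;
  \<open>c \<noteq> 0\<close> keeps the limiting denominator nonzero. Shifting the index to
  \<open>Suc n\<close> first removes the truncated subtraction.\<close>

lemma tendsto_linear_recurrence_ratio:
  fixes c d p q :: real
  assumes "c \<noteq> 0" "\<bar>q\<bar> < p"
  shows "(\<lambda>n. (c * p ^ (n - 1) + d * q ^ (n - 1)) / (c * p ^ n + d * q ^ n)) \<longlonglongrightarrow> 1 / p"
proof (rule LIMSEQ_imp_Suc)
  have p: "p > 0" using assms by linarith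
  have "(\<lambda>n. (q / p) ^ n) \<longlonglongrightarrow> 0"
    using assms by (intro LIMSEQ_power_zero) simp
  then have "(\<lambda>n. (c + d * (q / p) ^ n) / (c * p + d * q * (q / p) ^ n))
      \<longlonglongrightarrow> (c + d * 0) / (c * p + d * q * 0)"
    using assms p by (intro tendsto_intros) auto
  also have "(\<lambda>n. (c + d * (q / p) ^ n) / (c * p + d * q * (q / p) ^ n)) =
      (\<lambda>n. (c * p ^ n + d * q ^ n) / (c * p ^ Suc n + d * q ^ Suc n))"
  proof
    fix n
    have "(c + d * (q / p) ^ n) / (c * p + d * q * (q / p) ^ n) =
        (p ^ n * (c + d * (q / p) ^ n)) / (p ^ n * (c * p + d * q * (q / p) ^ n))"
      using p by simp
    also have "p ^ n * (c + d * (q / p) ^ n) = c * p ^ n + d * q ^ n"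
      using p by (simp add: power_divide field_simps)
    also have "p ^ n * (c * p + d * q * (q / p) ^ n) = c * p ^ Suc n + d * q ^ Suc n"
      using p by (simp add: power_divide field_simps)
    finally show "(c + d * (q / p) ^ n) / (c * p + d * q * (q / p) ^ n) =
        (c * p ^ n + d * q ^ n) / (c * p ^ Suc n + d * q ^ Suc n)" .
  qed
  finally show "(\<lambda>n. (c * p ^ (Suc n - 1) + d * q ^ (Suc n - 1)) / (c * p ^ Suc n + d * q ^ Suc n))
      \<longlonglongrightarrow> 1 / p"
    using assms by simp
qed

lemma beta_cr_tendsto:
  assumes "\<kappa> > 0" "b0 > 0"
    and init1: "c1 * lambda1 \<kappa> b0 + c2 * lambda2 \<kappa> b0 = 1 + \<kappa> / (2 * b0)"
    and init2: "c1 * (lambda1 \<kappa> b0)\<^sup>2 + c2 * (lambda2 \<kappa> b0)\<^sup>2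
           = 1 + 3 * \<kappa> / (2 * b0) + \<kappa>\<^sup>2 / (4 * b0\<^sup>2)"
  shows "beta_cr \<kappa> b0 c1 c2 \<longlonglongrightarrow> b0 * (sqrt (1 + 2 * \<kappa> / b0) - 1)"
proof -
  define s where "s = sqrt (1 + 2 * \<kappa> / b0)"
  define p where "p = lambda1 \<kappa> b0"
  define q where "q = lambda2 \<kappa> b0"
  have s: "s > 1" using assms(1,2) by (simp add: s_def)
  \<comment> \<open>With \<kappa>, \<open>p\<close> and \<open>q\<close> written through
    \<open>s\<close>, the remaining identities are polynomial in \<open>s\<close>.\<close>
  have \<kappa>: "\<kappa> = b0 * ((s\<^sup>2 - 1) / 2)"
    using assms(1,2) by (simp add: s_def field_simps)
  have p: "p = (s + 1)\<^sup>2 / 4" and q: "q = (s - 1)\<^sup>2 / 4"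
    using assms(1,2) by (simp_all add: p_def q_def s_def lambda1_eq_square lambda2_eq_square)
  have pq: "p - q = s" by (simp add: p q power2_eq_square field_simps)
  \<comment> \<open>Subtracting \<open>q\<close> times the first initial condition from the second
    eliminates \<open>c2\<close>.\<close>
  have "c1 * p * (p - q) = (c1 * p\<^sup>2 + c2 * q\<^sup>2) - q * (c1 * p + c2 * q)"
    by algebra
  also have "\<dots> = (1 + 3 * ((s\<^sup>2 - 1) / 2) / 2 + ((s\<^sup>2 - 1) / 2)\<^sup>2 / 4)
      - q * (1 + ((s\<^sup>2 - 1) / 2) / 2)"
    using init1 init2 assms(2)
    unfolding p_def[symmetric] q_def[symmetric] by (simp add: \<kappa> power_mult_distrib power_divide)
  also have "\<dots> = (s + 1) ^ 3 / 8"
    unfolding q by (simp add: field_simps) algebra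
  finally have "c1 \<noteq> 0" using s by auto
  moreover have "\<bar>q\<bar> < p" using pq s by (simp add: q)
  ultimately have ratio:
    "(\<lambda>n. (c1 * p ^ (n - 1) + c2 * q ^ (n - 1)) / (c1 * p ^ n + c2 * q ^ n)) \<longlonglongrightarrow> 1 / p"
    by (rule tendsto_linear_recurrence_ratio)
  \<comment> \<open>Division by zero gives 0, while the ratio tends to
    \<open>1 / p \<noteq> 0\<close>; hence the denominator is eventually nonzero.\<close>
  have nz: "\<forall>\<^sub>F n in sequentially. c1 * p ^ n + c2 * q ^ n \<noteq> 0"
    using tendsto_imp_eventually_ne[OF ratio, of 0] \<open>\<bar>q\<bar> < p\<close>
    by (force elim: eventually_mono)
  have "(\<lambda>n. \<kappa> - \<kappa>\<^sup>2 / (2 * b0) *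
      ((c1 * p ^ (n - 1) + c2 * q ^ (n - 1)) / (c1 * p ^ n + c2 * q ^ n)))
      \<longlonglongrightarrow> \<kappa> - \<kappa>\<^sup>2 / (2 * b0) * (1 / p)"
    by (intro tendsto_intros ratio)
  moreover have "\<forall>\<^sub>F n in sequentially. \<kappa> - \<kappa>\<^sup>2 / (2 * b0) *
      ((c1 * p ^ (n - 1) + c2 * q ^ (n - 1)) / (c1 * p ^ n + c2 * q ^ n)) = beta_cr \<kappa> b0 c1 c2 n"
    using nz by eventually_elim (simp add: beta_cr_def p_def[symmetric] q_def[symmetric] diff_divide_distrib)
  ultimately have "beta_cr \<kappa> b0 c1 c2 \<longlonglongrightarrow> \<kappa> - \<kappa>\<^sup>2 / (2 * b0) * (1 / p)"
    by (rule Lim_transform_eventually)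
  also have "\<kappa> - \<kappa>\<^sup>2 / (2 * b0) * (1 / p) = b0 * (s - 1)"
  proof -
    \<comment> \<open>Since \<open>s\<^sup>2 - 1 = (s - 1) * (s + 1)\<close>, the square of \<kappa>
      contains the factor \<open>p\<close>, which cancels.\<close>
    have "\<kappa>\<^sup>2 = 2 * b0 * p * (b0 * (s - 1)\<^sup>2 / 2)"
      unfolding \<kappa> p by (simp add: power2_eq_square field_simps)
    then have "\<kappa>\<^sup>2 / (2 * b0) * (1 / p) = b0 * (s - 1)\<^sup>2 / 2"
      using \<open>\<bar>q\<bar> < p\<close> assms(2) by auto
    then show ?thesis by (simp add: \<kappa> power2_eq_square field_simps)
  qed
  finally show ?thesis by (simp add: s_def)
qed

text \<open>The limiting form of the condition is read as follows: strictly on either side of the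
  threshold, the condition eventually holds or eventually fails. Equality is left open, as the limit
  alone does not decide it.\<close>

theorem theorem3p1:
  fixes \<kappa> b0 c1 c2 :: real and b :: "nat \<Rightarrow> real"
  assumes "\<kappa> > 0" and "b0 > 0"
    and "branching_law b" and "b 0 = b0"
    and "c1 * lambda1 \<kappa> b0 + c2 * lambda2 \<kappa> b0 = 1 + \<kappa> / (2 * b0)"
    and "c1 * (lambda1 \<kappa> b0)\<^sup>2 + c2 * (lambda2 \<kappa> b0)\<^sup>2
           = 1 + 3 * \<kappa> / (2 * b0) + \<kappa>\<^sup>2 / (4 * b0\<^sup>2)"
  shows "pure_reproduction b = branching_intensity b + b0
    \<and> (\<lambda>n. beta_cr \<kappa> b0 c1 c2 n + b0) \<longlonglongrightarrow> b0 * sqrt (1 + 2 * \<kappa> / b0)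
    \<and> (pure_reproduction b > b0 * sqrt (1 + 2 * \<kappa> / b0) \<longrightarrow>
         (\<forall>\<^sub>F n in sequentially. branching_intensity b > beta_cr \<kappa> b0 c1 c2 n))
    \<and> (pure_reproduction b < b0 * sqrt (1 + 2 * \<kappa> / b0) \<longrightarrow>
         (\<forall>\<^sub>F n in sequentially. \<not> branching_intensity b > beta_cr \<kappa> b0 c1 c2 n))"
proof -
  let ?s = "sqrt (1 + 2 * \<kappa> / b0)"
  have eq: "pure_reproduction b = branching_intensity b + b0"
    using pure_reproduction_eq[OF assms(3)] assms(4) by simp
  have lim: "beta_cr \<kappa> b0 c1 c2 \<longlonglongrightarrow> b0 * (?s - 1)"
    using assms by (intro beta_cr_tendsto)
  have "(\<lambda>n. beta_cr \<kappa> b0 c1 c2 n + b0) \<longlonglongrightarrow> b0 * ?s"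
    using tendsto_add[OF lim tendsto_const[of b0]] by (simp add: algebra_simps)
  moreover have "\<forall>\<^sub>F n in sequentially. branching_intensity b > beta_cr \<kappa> b0 c1 c2 n"
    if "pure_reproduction b > b0 * ?s"
    using that by (intro order_tendstoD(2)[OF lim]) (simp add: eq algebra_simps)
  moreover have "\<forall>\<^sub>F n in sequentially. \<not> branching_intensity b > beta_cr \<kappa> b0 c1 c2 n"
    if "pure_reproduction b < b0 * ?s"
  proof -
    have "\<forall>\<^sub>F n in sequentially. branching_intensity b < beta_cr \<kappa> b0 c1 c2 n"
      using that by (intro order_tendstoD(1)[OF lim]) (simp add: eq algebra_simps)
    then show ?thesis by (auto elim: eventually_mono)
  qed
  ultimately show ?thesis using eq by blast
qed

end
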